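(* Let $k=(k_1,k_2,k_3,k_4)\in\mathbb{R}^4$ and, for $0<q<1$, let $(a,b,c,d)=(q^{k_1},-q^{k_2},q^{k_3+1/2},-q^{k_4+1/2})$. As $q\to1$, the second type non-symmetric contiguous shift operators $\frac{1}{q-1}\mathcal{E}^q_{2,+}$ and $\frac{1}{q-1}\mathcal{E}^q_{2,-}$ specialise (i.e. converge coefficientwise when applied to any Laurent polynomial in $\mathbb{C}[z,z^{-1}]$) to \[ -\left(\frac{1-z^{-1}}{1+z^{-1}}z\partial_z+k_1+k_3-\frac12+\frac{1-z^{-1}}{1+z^{-1}}\,\frac{1}{z-z^{-1}}(1-s_1)\right) \] and \[ -\left(\frac{1+z^{-1}}{1-z^{-1}}z\partial_z+k_2+k_4-\frac12-\frac{1+z^{-1}}{1-z^{-1}}\,\frac{1}{z-z^{-1}}(1-s_1)\right), \] respectively.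
   Context: $\mathbb{C}[z,z^{-1}]$ is the ring of Laurent polynomials, $\mathbb{C}[z,z^{-1}]_0$ its subring of elements invariant under $z\mapsto z^{-1}$; $(s_1f)(z)=f(z^{-1})$, $(Tf)(z)=f(q^{1/2}z)$. $v_3=\frac12(1,-1,1,-1)$ and $\epsilon_1,\dots,\epsilon_4$ is the standard basis of $\mathbb{R}^4$. Define operators on $\mathbb{C}[z,z^{-1}]_0$, for $(u_1,u_2,u_3,u_4)=(a,b,c,d)$: \[ E^q_{ij}=E^q_{ij,k}=\frac{A_{ij}(z)T-A_{ij}(z^{-1})T^{-1}}{z-z^{-1}},\qquad A_{ij}(z)=-z^{-1}(1-u_iq^{-1/2}z)(1-u_jq^{-1/2}z). \] A subscript $k+h$ means $k$ is replaced by $k+h$, i.e. $(a,b,c,d)$ by $(aq^{h_1},bq^{h_2},cq^{h_3},dq^{h_4})$. Let $\mathcal{B}_{\mathrm{K},k}:(\mathbb{C}[z,z^{-1}]_0)^2\to\mathbb{C}[z,z^{-1}]$ be the isomorphism $(f_1,f_2)^T\mapsto f_1+z^{-1}(1-az)(1-bz)f_2$. Then \[ \mathcal{E}^q_{2,+}=\mathcal{B}_{\mathrm{K},k-v_3}\begin{pmatrix}E^q_{13,k}&0\\0&q^{-1/2}E^q_{13,k+\epsilon_1+\epsilon_2}\end{pmatrix}\mathcal{B}_{\mathrm{K},k}^{-1},\qquad \mathcal{E}^q_{2,-}=\mathcal{B}_{\mathrm{K},k+v_3}\begin{pmatrix}E^q_{24,k}&0\\0&q^{-1/2}E^q_{24,k+\epsilon_1+\epsilon_2}\end{pmatrix}\mathcal{B}_{\mathrm{K},k}^{-1}.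 \] *)

theory Defs
  imports
    "HOL-Analysis.Analysis"
    "HOL-Library.Poly_Mapping"
    "HOL-Computational_Algebra.Polynomial_Factorial"
begin

section \<open>Laurent polynomials\<close>

text \<open>
  Elements of \<open>\<complex>[z, z\<^sup>-\<^sup>1]\<close> are finitely supported coefficient functions on the integers; the
  multiplication of \<^theory>\<open>HOL-Library.Poly_Mapping\<close> is the convolution product.
  The quotient field \<open>\<complex>(z)\<close> is \<open>laurent fract\<close>, with embedding \<^const>\<open>to_fract\<close>.
\<close>

type_synonym laurent = "int \<Rightarrow>\<^sub>0 complex"

definition lconst :: "complex \<Rightarrow> laurent"
  where "lconst c = Poly_Mapping.single 0 c"

definition lz :: laurent
  where "lz = Poly_Mapping.single 1 1"

definition lzinv :: laurent
  where "lzinv = Poly_Mapping.single (- 1) 1"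

text \<open>\<open>(s1 f)(z) = f(z\<^sup>-\<^sup>1)\<close>, \<open>(dilate c f)(z) = f(c z)\<close>, and the Euler operator \<open>z \<partial>\<^sub>z\<close>.\<close>

definition s1 :: "laurent \<Rightarrow> laurent"
  where "s1 f = Poly_Mapping.map_key uminus f"

definition dilate :: "complex \<Rightarrow> laurent \<Rightarrow> laurent"
  where "dilate c f = Poly_Mapping.mapp (\<lambda>n x. c powi n * x) f"

definition z_deriv :: "laurent \<Rightarrow> laurent"
  where "z_deriv f = Poly_Mapping.mapp (\<lambda>n x. of_int n * x) f"

definition sym_laurent :: "laurent set"
  where "sym_laurent = {f. s1 f = f}"

text \<open>
  Reads an element of \<open>\<complex>(z)\<close> as a Laurent polynomial; meaningful only on the range of
  \<^const>\<open>to_fract\<close>.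
\<close>

definition as_laurent :: "laurent fract \<Rightarrow> laurent"
  where "as_laurent = inv to_fract"


section \<open>The operators\<close>

definition qT :: "real \<Rightarrow> laurent \<Rightarrow> laurent"
  where "qT q = dilate (complex_of_real (q powr (1/2)))"

definition qT_inv :: "real \<Rightarrow> laurent \<Rightarrow> laurent"
  where "qT_inv q = dilate (complex_of_real (q powr (- 1/2)))"

text \<open>
  The parameters \<open>(a, b, c, d)\<close> form a vector \<open>u\<close>; replacing the multiplicity \<open>k\<close> by \<open>k + h\<close>
  multiplies \<open>u $ i\<close> by \<open>q powr (h $ i)\<close>.
\<close>

definition kshift :: "real \<Rightarrow> real ^ 4 \<Rightarrow> complex ^ 4 \<Rightarrow> complex ^ 4"
  where "kshift q h u = (\<chi> i. u $ i * complex_of_real (q powr (h $ i)))"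

definition A_poly :: "real \<Rightarrow> complex ^ 4 \<Rightarrow> 4 \<Rightarrow> 4 \<Rightarrow> laurent"
  where "A_poly q u i j =
    - lzinv * (1 - lconst (u $ i * complex_of_real (q powr (- 1/2))) * lz)
            * (1 - lconst (u $ j * complex_of_real (q powr (- 1/2))) * lz)"

text \<open>
  The quotient is taken in \<open>\<complex>(z)\<close>. On \<^const>\<open>sym_laurent\<close> it is a (symmetric) Laurent polynomial:
  see \<open>to_fract_E_op\<close> and \<open>E_op_sym\<close> below.
\<close>

definition E_op :: "real \<Rightarrow> complex ^ 4 \<Rightarrow> 4 \<Rightarrow> 4 \<Rightarrow> laurent \<Rightarrow> laurent"
  where "E_op q u i j f = as_laurent
    (to_fract (A_poly q u i j * qT q f - s1 (A_poly q u i j) * qT_inv q f)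
      / to_fract (lz - lzinv))"

definition B_K :: "complex ^ 4 \<Rightarrow> laurent \<times> laurent \<Rightarrow> laurent"
  where "B_K u = (\<lambda>(f1, f2).
    f1 + lzinv * (1 - lconst (u $ 1) * lz) * (1 - lconst (u $ 2) * lz) * f2)"

text \<open>
  The inverse is that of the restriction of \<^const>\<open>B_K\<close> to pairs of symmetric Laurent polynomials,
  which is bijective if \<open>a b \<noteq> 1\<close>: see \<open>bij_betw_B_K\<close> below.
\<close>

definition B_K_inv :: "complex ^ 4 \<Rightarrow> laurent \<Rightarrow> laurent \<times> laurent"
  where "B_K_inv u = inv_into (sym_laurent \<times> sym_laurent) (B_K u)"

definition v3 :: "real ^ 4"
  where "v3 = (1/2) *\<^sub>R vector [1, - 1, 1, - 1]"

definition eps :: "4 \<Rightarrow> real ^ 4"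
  where "eps i = axis i 1"

definition nonsym_E2_plus :: "real \<Rightarrow> complex ^ 4 \<Rightarrow> laurent \<Rightarrow> laurent"
  where "nonsym_E2_plus q u =
    B_K (kshift q (- v3) u) \<circ>
    map_prod (E_op q u 1 3)
      (\<lambda>f. lconst (complex_of_real (q powr (- 1/2))) * E_op q (kshift q (eps 1 + eps 2) u) 1 3 f) \<circ>
    B_K_inv u"

definition nonsym_E2_minus :: "real \<Rightarrow> complex ^ 4 \<Rightarrow> laurent \<Rightarrow> laurent"
  where "nonsym_E2_minus q u =
    B_K (kshift q v3 u) \<circ>
    map_prod (E_op q u 2 4)
      (\<lambda>f. lconst (complex_of_real (q powr (- 1/2))) * E_op q (kshift q (eps 1 + eps 2) u) 2 4 f) \<circ>
    B_K_inv u"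


section \<open>Parameters and the limits\<close>

definition params :: "real \<Rightarrow> real ^ 4 \<Rightarrow> complex ^ 4"
  where "params q k = vector
    [complex_of_real (q powr (k $ 1)), - complex_of_real (q powr (k $ 2)),
     complex_of_real (q powr (k $ 3 + 1/2)), - complex_of_real (q powr (k $ 4 + 1/2))]"

text \<open>
  The individual summands of the limit operators are only rational functions in \<open>z\<close>, so the values
  are taken in \<open>\<complex>(z)\<close>.
\<close>

definition E2_plus_limit :: "real ^ 4 \<Rightarrow> laurent \<Rightarrow> laurent fract"
  where "E2_plus_limit k f =
    - ((1 - to_fract lzinv) / (1 + to_fract lzinv) * to_fract (z_deriv f)
       + to_fract (lconst (complex_of_real (k $ 1 + k $ 3 - 1/2)) * f)
       + (1 - to_fract lzinv) / (1 + to_fract lzinv)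
         * (1 / (to_fract lz - to_fract lzinv)) * to_fract (f - s1 f))"

definition E2_minus_limit :: "real ^ 4 \<Rightarrow> laurent \<Rightarrow> laurent fract"
  where "E2_minus_limit k f =
    - ((1 + to_fract lzinv) / (1 - to_fract lzinv) * to_fract (z_deriv f)
       + to_fract (lconst (complex_of_real (k $ 2 + k $ 4 - 1/2)) * f)
       - (1 + to_fract lzinv) / (1 - to_fract lzinv)
         * (1 / (to_fract lz - to_fract lzinv)) * to_fract (f - s1 f))"

text \<open>
  Coefficientwise convergence as \<open>q\<close> tends to 1 from below, on every Laurent polynomial. In
  particular the limit operator must map \<open>\<complex>[z, z\<^sup>-\<^sup>1]\<close> into itself.
\<close>

definition specialises :: "(real \<Rightarrow> laurent \<Rightarrow> laurent) \<Rightarrow> (laurent \<Rightarrow> laurent fract) \<Rightarrow> bool"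
  where "specialises P L \<longleftrightarrow>
    (\<forall>f. \<exists>g. to_fract g = L f \<and>
      (\<forall>n. ((\<lambda>q. Poly_Mapping.lookup (P q f) n) \<longlongrightarrow> Poly_Mapping.lookup g n) (at_left 1)))"


section \<open>Well-definedness\<close>

lemma vector_4:
  "(vector [x, y, z, w] :: ('a::zero) ^ 4) $ 1 = x"
  "(vector [x, y, z, w] :: ('a::zero) ^ 4) $ 2 = y"
  "(vector [x, y, z, w] :: ('a::zero) ^ 4) $ 3 = z"
  "(vector [x, y, z, w] :: ('a::zero) ^ 4) $ 4 = w"
  unfolding vector_def by simp_all

lemma as_laurent_to_fract [simp]: "as_laurent (to_fract f) = f"
  unfolding as_laurent_def by (rule inv_f_f) (simp add: inj_def)

lemma lookup_s1 [simp]: "Poly_Mapping.lookup (s1 f) n = Poly_Mapping.lookup f (- n)"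
  unfolding s1_def by (subst map_key.rep_eq) (auto simp: inj_def)

lemma lookup_dilate [simp]:
  "Poly_Mapping.lookup (dilate c f) n = c powi n * Poly_Mapping.lookup f n"
  unfolding dilate_def by (auto simp: lookup_mapp when_def in_keys_iff)

lemma lookup_z_deriv [simp]:
  "Poly_Mapping.lookup (z_deriv f) n = of_int n * Poly_Mapping.lookup f n"
  unfolding z_deriv_def by (auto simp: lookup_mapp when_def in_keys_iff)

lemma lookup_lconst_mult [simp]:
  "Poly_Mapping.lookup (lconst c * f) n = c * Poly_Mapping.lookup f n"
  unfolding lconst_def mult_map_scale_conv_mult [symmetric]
  by (auto simp: map.rep_eq when_def)

lemma s1_s1 [simp]: "s1 (s1 f) = f"
  by (rule poly_mapping_eqI) simp

lemma s1_add: "s1 (f + g) = s1 f + s1 g"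
  by (rule poly_mapping_eqI) (simp add: lookup_add)

lemma s1_diff: "s1 (f - g) = s1 f - s1 g"
  by (rule poly_mapping_eqI) (simp add: lookup_minus)

lemma s1_uminus: "s1 (- f) = - s1 f"
  by (rule poly_mapping_eqI) simp

lemma s1_0 [simp]: "s1 0 = 0"
  by (rule poly_mapping_eqI) simp

lemma s1_single [simp]: "s1 (Poly_Mapping.single n c) = Poly_Mapping.single (- n) c"
  by (rule poly_mapping_eqI) (auto simp: lookup_single when_def)

lemma laurent_induct:
  assumes "P 0" and "\<And>f n c. P f \<Longrightarrow> P (Poly_Mapping.single n c + f)"
  shows "P (f :: laurent)"
proof (induction f rule: update_induct)
  case const
  show ?case by fact
next
  case (update f a b)
  have "Poly_Mapping.update a b f = Poly_Mapping.single a b + f"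
    using update(1)
    by (intro poly_mapping_eqI)
      (auto simp: lookup_update lookup_add lookup_single when_def in_keys_iff)
  with assms(2) [OF update(3)] show ?case by simp
qed

lemma s1_single_mult: "s1 (Poly_Mapping.single n c * f) = Poly_Mapping.single (- n) c * s1 f"
  by (induction f rule: laurent_induct) (simp_all add: ring_distribs s1_add mult_single)

lemma s1_mult: "s1 (f * g) = s1 f * s1 g"
  by (induction f rule: laurent_induct) (simp_all add: ring_distribs s1_add s1_single_mult)

lemma s1_lconst [simp]: "s1 (lconst c) = lconst c"
  by (simp add: lconst_def)

lemma s1_lz [simp]: "s1 lz = lzinv" and s1_lzinv [simp]: "s1 lzinv = lz"
  by (simp_all add: lz_def lzinv_def)

lemma s1_1 [simp]: "s1 1 = 1"
  using s1_single [of 0 1] by simp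

lemma lz_lzinv [simp]: "lz * lzinv = 1" "lzinv * lz = 1"
  by (simp_all add: lz_def lzinv_def mult_single)

lemma lconst_mult: "lconst (a * b) = lconst a * lconst b"
  by (simp add: lconst_def mult_single)

lemma lconst_1 [simp]: "lconst 1 = 1"
  by (simp add: lconst_def)

lemma lconst_0 [simp]: "lconst 0 = 0"
  by (simp add: lconst_def)

lemma lconst_nonzero:
  assumes "c \<noteq> 0"
  shows "lconst c \<noteq> 0"
proof
  assume "lconst c = 0"
  then have "Poly_Mapping.lookup (lconst c) 0 = 0" by simp
  with assms show False by (simp add: lconst_def)
qed

lemma lconst_add: "lconst (a + b) = lconst a + lconst b"
  by (simp add: lconst_def single_add)

lemma lconst_diff: "lconst (a - b) = lconst a - lconst b"
  by (simp add: lconst_def single_diff)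

lemma lz_power: "lz ^ n = Poly_Mapping.single (int n) 1"
  and lzinv_power: "lzinv ^ n = Poly_Mapping.single (- int n) 1"
  by (induction n) (simp_all add: lz_def lzinv_def mult_single)

lemma lz_neq_lzinv [simp]: "lz \<noteq> lzinv"
proof
  assume "lz = lzinv"
  then have "Poly_Mapping.lookup lz 1 = Poly_Mapping.lookup lzinv 1" by simp
  then show False by (simp add: lz_def lzinv_def lookup_single)
qed

lemma dvd_minus_s1: "(lz - lzinv) dvd (f - s1 f)"
proof (induction f rule: laurent_induct)
  case 1
  show ?case by simp
next
  case (2 f n c)
  have pos: "(lz - lzinv) dvd (Poly_Mapping.single (int m) c - Poly_Mapping.single (- int m) c)" for m c
  proof -
    have "Poly_Mapping.single (int m) c - Poly_Mapping.single (- int m) c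
        = lconst c * (lz ^ m - lzinv ^ m)"
      by (simp add: lz_power lzinv_power lconst_def ring_distribs mult_single)
    then show ?thesis
      by (simp add: power_diff_sumr2)
  qed
  have "(lz - lzinv) dvd (Poly_Mapping.single n c - Poly_Mapping.single (- n) c)"
  proof (cases n rule: int_cases2)
    case (nonneg m)
    then show ?thesis using pos [of m c] by simp
  next
    case (nonpos m)
    then have "Poly_Mapping.single n c - Poly_Mapping.single (- n) c
        = - (Poly_Mapping.single (int m) c - Poly_Mapping.single (- int m) c)"
      by simp
    with pos [of m c] show ?thesis by (simp only: dvd_minus_iff)
  qed
  from dvd_add [OF this 2] show ?case
    by (simp add: s1_add algebra_simps)
qed

lemma s1_dilate:
  assumes "c * d = 1"
  shows "s1 (dilate c f) = dilate d (s1 f)"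
proof -
  have "d = inverse c"
    using assms by (metis inverse_unique)
  then show ?thesis
    by (intro poly_mapping_eqI) (simp add: power_int_minus power_int_inverse)
qed

lemma qT_qT_inv:
  assumes "0 < q"
  shows "qT q (qT_inv q f) = f" "qT_inv q (qT q f) = f"
proof -
  define c d where "c = complex_of_real (q powr (1/2))" and "d = complex_of_real (q powr (- 1/2))"
  have "c * d = 1"
    unfolding c_def d_def using assms by (simp flip: of_real_mult powr_add)
  then have *: "c powi n * d powi n = 1" for n
    by (simp flip: power_int_mult_distrib)
  have **: "c powi n * (d powi n * x) = x" "d powi n * (c powi n * x) = x" for n x
    using * [of n] by (simp_all add: mult.assoc [symmetric] mult.commute [of "d powi n"])
  show "qT q (qT_inv q f) = f" "qT_inv q (qT q f) = f"
    unfolding qT_def qT_inv_def c_def [symmetric] d_def [symmetric]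
    by (rule poly_mapping_eqI, simp add: **)+
qed

lemma s1_qT:
  assumes "0 < q"
  shows "s1 (qT q f) = qT_inv q (s1 f)"
  unfolding qT_def qT_inv_def
  by (rule s1_dilate) (use assms in \<open>simp flip: of_real_mult powr_add\<close>)

lemma E_op_eq:
  assumes "0 < q" "f \<in> sym_laurent"
  shows "(lz - lzinv) * E_op q u i j f
    = A_poly q u i j * qT q f - s1 (A_poly q u i j) * qT_inv q f"
proof -
  let ?N = "A_poly q u i j * qT q f - s1 (A_poly q u i j) * qT_inv q f"
  have "?N = A_poly q u i j * qT q f - s1 (A_poly q u i j * qT q f)"
    using assms by (simp add: s1_mult s1_qT sym_laurent_def)
  then obtain g where g: "?N = (lz - lzinv) * g"
    using dvd_minus_s1 [of "A_poly q u i j * qT q f"] by (auto elim: dvdE)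
  have "to_fract ?N / to_fract (lz - lzinv) = to_fract g"
    unfolding g to_fract_mult by (simp del: to_fract_diff)
  then have "E_op q u i j f = g"
    by (simp only: E_op_def as_laurent_to_fract)
  with g show ?thesis by simp
qed

lemma to_fract_E_op:
  assumes "0 < q" "f \<in> sym_laurent"
  shows "to_fract (E_op q u i j f) =
    to_fract (A_poly q u i j * qT q f - s1 (A_poly q u i j) * qT_inv q f) / to_fract (lz - lzinv)"
  unfolding E_op_eq [OF assms, symmetric] to_fract_mult by (simp del: to_fract_diff)

lemma E_op_sym:
  assumes "0 < q" "f \<in> sym_laurent"
  shows "E_op q u i j f \<in> sym_laurent"
proof -
  let ?N = "A_poly q u i j * qT q f - s1 (A_poly q u i j) * qT_inv q f"
  have f: "s1 f = f" using assms by (simp add: sym_laurent_def)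
  have "s1 (qT_inv q f) = qT q f"
    using s1_qT [OF assms(1), of f] f by (metis s1_s1)
  then have "s1 ?N = - ?N"
    using assms f by (simp add: s1_diff s1_mult s1_qT)
  then have "s1 ((lz - lzinv) * E_op q u i j f) = - ((lz - lzinv) * E_op q u i j f)"
    by (simp only: E_op_eq [OF assms])
  then have "(lz - lzinv) * s1 (E_op q u i j f) = (lz - lzinv) * E_op q u i j f"
    by (simp add: s1_mult s1_diff algebra_simps)
  then show ?thesis
    by (simp add: sym_laurent_def)
qed

lemma bij_betw_B_K:
  assumes "u $ 1 * u $ 2 \<noteq> 1"
  shows "bij_betw (B_K u) (sym_laurent \<times> sym_laurent) UNIV"
proof -
  define a b where "a = u $ 1" and "b = u $ 2"
  define w where "w = lzinv * (1 - lconst a * lz) * (1 - lconst b * lz)"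
  define e where "e = 1 - a * b"
  have e: "e \<noteq> 0" using assms by (simp add: e_def a_def b_def)
  have B: "B_K u (f, g) = f + w * g" for f g
    by (simp add: B_K_def w_def a_def b_def)
  have w: "w = lzinv - lconst (a + b) + lconst (a * b) * lz"
  proof -
    have "w = lzinv - (lconst a + lconst b) * (lzinv * lz) + lconst a * lconst b * lz * (lzinv * lz)"
      unfolding w_def by (simp add: algebra_simps del: lz_lzinv)
    then show ?thesis by (simp add: lconst_add lconst_mult)
  qed
  have anti: "w - s1 w = - lconst e * (lz - lzinv)"
    unfolding w e_def by (simp add: s1_add s1_diff s1_mult lconst_diff algebra_simps)
  have inj: "inj_on (B_K u) (sym_laurent \<times> sym_laurent)"
  proof (rule inj_onI, clarify)
    fix f g f' g'
    assume *: "f \<in> sym_laurent" "g \<in> sym_laurent" "f' \<in> sym_laurent" "g' \<in> sym_laurent"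
      and eq: "B_K u (f, g) = B_K u (f', g')"
    have 1: "f + w * g = f' + w * g'" using eq by (simp add: B)
    then have "s1 (f + w * g) = s1 (f' + w * g')" by simp
    then have 2: "f + s1 w * g = f' + s1 w * g'"
      using * by (simp add: s1_add s1_mult sym_laurent_def)
    have "(w - s1 w) * g = (f + w * g) - (f + s1 w * g)" by (simp add: algebra_simps)
    also have "\<dots> = (w - s1 w) * g'" unfolding 1 2 by (simp add: algebra_simps)
    finally have "g = g'"
      using lconst_nonzero [OF e] unfolding anti by auto
    with 1 show "f = f' \<and> g = g'" by simp
  qed
  have surj: "h \<in> B_K u ` (sym_laurent \<times> sym_laurent)" for h
  proof -
    obtain g0 where g0: "h - s1 h = (lz - lzinv) * g0"
      using dvd_minus_s1 by (auto elim: dvdE)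
    define g where "g = lconst (- inverse e) * g0"
    have "s1 (h - s1 h) = - (h - s1 h)" by (simp add: s1_diff)
    then have "(lz - lzinv) * s1 g0 = (lz - lzinv) * g0"
      unfolding g0 by (simp add: s1_mult s1_diff algebra_simps)
    then have sg: "s1 g = g" by (simp add: g_def s1_mult)
    have "lconst e * lconst (- inverse e) = - 1"
      using e by (simp add: lconst_def mult_single single_uminus)
    moreover have "(w - s1 w) * g = - (lconst e * lconst (- inverse e)) * ((lz - lzinv) * g0)"
      unfolding anti g_def by (simp only: mult_minus_left mult_minus_right mult.assoc mult.left_commute)
    ultimately have "(w - s1 w) * g = (lz - lzinv) * g0" by simp
    with g0 have "h - s1 h = w * g - s1 w * g" by (simp only: left_diff_distrib)
    then have "s1 h - s1 w * g = h - w * g" by algebra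
    then have "s1 (h - w * g) = h - w * g" by (simp only: s1_diff s1_mult sg)
    then have "h = B_K u (h - w * g, g)" "(h - w * g, g) \<in> sym_laurent \<times> sym_laurent"
      using sg by (simp_all add: B sym_laurent_def)
    then show ?thesis by blast
  qed
  show ?thesis
    using inj surj by (auto simp: bij_betw_def)
qed

lemma params_nondegenerate:
  assumes "0 < q"
  shows "params q k $ 1 * params q k $ 2 \<noteq> 1"
proof -
  have "params q k $ 1 * params q k $ 2 = complex_of_real (- (q powr (k $ 1) * q powr (k $ 2)))"
    by (simp add: params_def vector_4)
  moreover have "- (q powr (k $ 1) * q powr (k $ 2)) < 0"
    using assms by simp
  ultimately show ?thesis
    by (metis of_real_eq_1_iff not_one_less_zero)
qed

lemma kshift_params:
  assumes "0 < q"
  shows "kshift q h (params q k) = params q (k + h)"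
  by (simp add: vec_eq_iff forall_4 kshift_def params_def vector_4 powr_add)

end

theory Submission
  imports Defs
begin

text \<open>
  At \<open>q = 1\<close> the polynomials \<open>A\<^sub>1\<^sub>3\<close> and \<open>A\<^sub>2\<^sub>4\<close> become \<open>- z\<^sup>-\<^sup>1 (1 - \<sigma> z)\<^sup>2\<close> with \<open>\<sigma> = 1\<close>
  and \<open>\<sigma> = - 1\<close>, which are symmetric; hence \<open>E\<^sub>i\<^sub>j\<close> vanishes there on symmetric Laurent polynomials,
  and \<open>E\<^sub>i\<^sub>j / (q - 1)\<close> tends to its derivative in \<open>q\<close>, namely
  \<open>(2 \<sigma> - z - z\<^sup>-\<^sup>1) / (z - z\<^sup>-\<^sup>1) \<cdot> z \<partial>\<^sub>z - \<kappa>\<close> with \<open>\<kappa> = k\<^sub>i + k\<^sub>j - 1/2\<close>. The shift by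
  \<open>\<epsilon>\<^sub>1 + \<epsilon>\<^sub>2\<close> replaces \<open>\<kappa>\<close> by \<open>\<kappa> + 1\<close>, while the factors \<open>q\<^sup>-\<^sup>1\<^sup>/\<^sup>2\<close> and the shifts by \<open>v\<^sub>3\<close>
  disappear in the limit. Writing \<open>f = f\<^sub>1 + (z\<^sup>-\<^sup>1 - z) f\<^sub>2\<close> with symmetric \<open>f\<^sub>1\<close>, \<open>f\<^sub>2\<close>, the term in
  \<open>f - s\<^sub>1 f = 2 (z\<^sup>-\<^sup>1 - z) f\<^sub>2\<close> of the limit operator accounts for the extra \<open>- f\<^sub>2\<close> and for the
  derivative of \<open>z\<^sup>-\<^sup>1 - z\<close>.
\<close>

section \<open>Coefficientwise limits of Laurent polynomials with bounded degrees\<close>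

text \<open>
  The uniform upper bound on the degrees is part of the notion: without it the limit would not
  commute with division by \<open>z - z\<^sup>-\<^sup>1\<close>.
\<close>

definition coeffs_tendsto :: "('a \<Rightarrow> laurent) \<Rightarrow> laurent \<Rightarrow> 'a filter \<Rightarrow> bool"
  where "coeffs_tendsto F g L \<longleftrightarrow>
    (\<exists>M. \<forall>\<^sub>F x in L. \<forall>n>M. Poly_Mapping.lookup (F x) n = 0) \<and>
    (\<forall>n. ((\<lambda>x. Poly_Mapping.lookup (F x) n) \<longlongrightarrow> Poly_Mapping.lookup g n) L)"

lemma coeffs_tendstoI:
  assumes "\<forall>\<^sub>F x in L. \<forall>n>M. Poly_Mapping.lookup (F x) n = 0"
    and "\<And>n. ((\<lambda>x. Poly_Mapping.lookup (F x) n) \<longlongrightarrow> Poly_Mapping.lookup g n) L"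
  shows "coeffs_tendsto F g L"
  using assms by (auto simp: coeffs_tendsto_def)

lemma lookup_single_1_mult:
  "Poly_Mapping.lookup (Poly_Mapping.single m 1 * f) n = Poly_Mapping.lookup (f :: laurent) (n - m)"
  by (induction f rule: laurent_induct)
    (auto simp: ring_distribs lookup_add mult_single lookup_single when_def)

lemma lookup_lz_mult: "Poly_Mapping.lookup (lz * f) n = Poly_Mapping.lookup f (n - 1)"
  and lookup_lzinv_mult: "Poly_Mapping.lookup (lzinv * f) n = Poly_Mapping.lookup f (n + 1)"
  by (simp_all add: lz_def lzinv_def lookup_single_1_mult)

lemma laurent_eventually_0: "\<exists>M. \<forall>n>M. Poly_Mapping.lookup (f :: laurent) n = 0"
proof -
  obtain M where "\<forall>n\<in>Poly_Mapping.keys f. n \<le> M"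
    using bdd_above_finite [OF finite_keys, of f] by (auto simp: bdd_above_def)
  then show ?thesis by (metis in_keys_iff not_le)
qed

lemma coeffs_tendsto_const: "coeffs_tendsto (\<lambda>_. f) f L"
proof -
  obtain M where "\<forall>n>M. Poly_Mapping.lookup f n = 0"
    using laurent_eventually_0 by blast
  then show ?thesis by (intro coeffs_tendstoI [of M]) simp_all
qed

lemma coeffs_tendsto_add:
  assumes "coeffs_tendsto F f L" "coeffs_tendsto G g L"
  shows "coeffs_tendsto (\<lambda>x. F x + G x) (f + g) L"
proof -
  obtain M N where "\<forall>\<^sub>F x in L. \<forall>n>M. Poly_Mapping.lookup (F x) n = 0"
    "\<forall>\<^sub>F x in L. \<forall>n>N. Poly_Mapping.lookup (G x) n = 0"
    using assms by (auto simp: coeffs_tendsto_def)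
  then have "\<forall>\<^sub>F x in L. \<forall>n>max M N. Poly_Mapping.lookup (F x + G x) n = 0"
    by eventually_elim (simp add: lookup_add)
  then show ?thesis
    by (rule coeffs_tendstoI)
      (use assms in \<open>auto simp: coeffs_tendsto_def lookup_add intro!: tendsto_add\<close>)
qed

lemma coeffs_tendsto_lconst_mult:
  assumes "(c \<longlongrightarrow> d) L" "coeffs_tendsto F f L"
  shows "coeffs_tendsto (\<lambda>x. lconst (c x) * F x) (lconst d * f) L"
proof -
  obtain M where "\<forall>\<^sub>F x in L. \<forall>n>M. Poly_Mapping.lookup (F x) n = 0"
    using assms by (auto simp: coeffs_tendsto_def)
  then have "\<forall>\<^sub>F x in L. \<forall>n>M. Poly_Mapping.lookup (lconst (c x) * F x) n = 0"
    by eventually_elim simp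
  with assms show ?thesis
    by (auto simp: coeffs_tendsto_def intro!: tendsto_mult)
qed

lemma coeffs_tendsto_uminus:
  assumes "coeffs_tendsto F f L"
  shows "coeffs_tendsto (\<lambda>x. - F x) (- f) L"
  using assms by (auto simp: coeffs_tendsto_def intro!: tendsto_minus)

lemma coeffs_tendsto_diff:
  assumes "coeffs_tendsto F f L" "coeffs_tendsto G g L"
  shows "coeffs_tendsto (\<lambda>x. F x - G x) (f - g) L"
  using coeffs_tendsto_add [OF assms(1) coeffs_tendsto_uminus [OF assms(2)]] by simp

lemma coeffs_tendsto_single_mult:
  assumes "coeffs_tendsto F f L"
  shows "coeffs_tendsto (\<lambda>x. Poly_Mapping.single m 1 * F x) (Poly_Mapping.single m 1 * f) L"
proof -
  obtain M where "\<forall>\<^sub>F x in L. \<forall>n>M. Poly_Mapping.lookup (F x) n = 0"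
    using assms by (auto simp: coeffs_tendsto_def)
  then have "\<forall>\<^sub>F x in L. \<forall>n>M+m. Poly_Mapping.lookup (Poly_Mapping.single m 1 * F x) n = 0"
    by eventually_elim (simp add: lookup_single_1_mult)
  with assms show ?thesis
    by (auto simp: coeffs_tendsto_def lookup_single_1_mult)
qed

lemmas coeffs_tendsto_lz_mult = coeffs_tendsto_single_mult [of _ _ _ 1, folded lz_def]
  and coeffs_tendsto_lzinv_mult = coeffs_tendsto_single_mult [of _ _ _ "- 1", folded lzinv_def]

section \<open>Division by z - z^-1\<close>

text \<open>
  The sum has a fixed number of terms as long as the degrees are bounded from above, so division by
  \<open>z - z\<^sup>-\<^sup>1\<close> preserves coefficientwise limits.
\<close>

lemma lookup_div_lz_diff_lzinv:
  assumes "\<forall>n>M. Poly_Mapping.lookup ((lz - lzinv) * h) n = 0" and "n + 2 * int K \<ge> M"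
  shows "Poly_Mapping.lookup h n =
    (\<Sum>j<K. Poly_Mapping.lookup ((lz - lzinv) * h) (n + 1 + 2 * int j))"
proof -
  let ?N = "\<lambda>n. Poly_Mapping.lookup ((lz - lzinv) * h) n"
  obtain M' where M': "\<forall>n>M'. Poly_Mapping.lookup h n = 0"
    using laurent_eventually_0 by blast
  \<comment> \<open>No bound on the degree of \<open>h\<close> is known in advance. The sum is
    therefore prolonged to \<open>K'\<close> terms, the extra ones being 0 by the bound on the
    product, so that it telescopes to an index beyond the support of \<open>h\<close>.\<close>
  define K' where "K' = max K (nat (M' + 1 - n))"
  have "(\<Sum>j<K. ?N (n + 1 + 2 * int j)) = (\<Sum>j<K'. ?N (n + 1 + 2 * int j))"
    by (rule sum.mono_neutral_left) (use assms in \<open>auto simp: K'_def\<close>)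
  also have "\<dots> = (\<Sum>j<K'. Poly_Mapping.lookup h (n + 2 * int j)
      - Poly_Mapping.lookup h (n + 2 * int (Suc j)))"
    by (rule sum.cong)
      (simp_all add: left_diff_distrib lookup_minus lookup_lz_mult lookup_lzinv_mult algebra_simps)
  also have "\<dots> = Poly_Mapping.lookup h n - Poly_Mapping.lookup h (n + 2 * int K')"
    by (subst sum_lessThan_telescope') simp
  also have "Poly_Mapping.lookup h (n + 2 * int K') = 0"
    using M' by (auto simp: K'_def)
  finally show ?thesis by simp
qed

lemma coeffs_tendsto_div_lz_diff_lzinv:
  assumes "coeffs_tendsto F ((lz - lzinv) * g) L"
    and "\<forall>\<^sub>F x in L. F x = (lz - lzinv) * H x"
  shows "coeffs_tendsto H g L"
proof -
  obtain M where M: "\<forall>\<^sub>F x in L. \<forall>n>M. Poly_Mapping.lookup (F x) n = 0"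
    using assms by (auto simp: coeffs_tendsto_def)
  obtain M' where M': "\<forall>n>M'. Poly_Mapping.lookup ((lz - lzinv) * g) n = 0"
    using laurent_eventually_0 by blast
  define B where "B = max M M'"
  have g: "\<forall>n>B. Poly_Mapping.lookup ((lz - lzinv) * g) n = 0"
    using M' by (simp add: B_def)
  have H: "\<forall>\<^sub>F x in L. \<forall>n>B. Poly_Mapping.lookup ((lz - lzinv) * H x) n = 0"
    using M assms(2) by eventually_elim (auto simp: B_def)
  have "\<forall>\<^sub>F x in L. \<forall>n>B. Poly_Mapping.lookup (H x) n = 0"
    using H
  proof eventually_elim
    case (elim x)
    \<comment> \<open>With \<open>K = 0\<close> the sum is empty: a degree bound for the product is
      one for the quotient.\<close>
    then show ?case using lookup_div_lz_diff_lzinv [OF elim, of _ 0] by auto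
  qed
  moreover have "((\<lambda>x. Poly_Mapping.lookup (H x) n) \<longlongrightarrow> Poly_Mapping.lookup g n) L" for n
  proof -
    \<comment> \<open>This \<open>K\<close> depends on \<open>n\<close> but not on \<open>x\<close>,
      so one finite sum computes the coefficient at \<open>n\<close> of \<open>g\<close> and of
      every \<open>H x\<close> near the limit.\<close>
    define K where "K = nat (B - n)"
    have K: "n + 2 * int K \<ge> B" by (simp add: K_def)
    have "\<forall>\<^sub>F x in L. (\<Sum>j<K. Poly_Mapping.lookup (F x) (n + 1 + 2 * int j))
        = Poly_Mapping.lookup (H x) n"
      using H assms(2) by eventually_elim (use lookup_div_lz_diff_lzinv [OF _ K] in simp)
    moreover have "((\<lambda>x. \<Sum>j<K. Poly_Mapping.lookup (F x) (n + 1 + 2 * int j)) \<longlongrightarrow>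
        (\<Sum>j<K. Poly_Mapping.lookup ((lz - lzinv) * g) (n + 1 + 2 * int j))) L"
      by (rule tendsto_sum) (use assms in \<open>simp add: coeffs_tendsto_def\<close>)
    ultimately show ?thesis
      unfolding lookup_div_lz_diff_lzinv [OF g K] by (blast intro: Lim_transform_eventually)
  qed
  ultimately show ?thesis by (auto simp: coeffs_tendsto_def)
qed

section \<open>Powers of q near 1\<close>

lemma tendsto_powr_at_1: "((\<lambda>q. q powr s) \<longlongrightarrow> 1) (at_left (1::real))"
proof -
  have "((\<lambda>q. q powr s) \<longlongrightarrow> 1 powr s) (at_left (1::real))"
    by (intro tendsto_intros) auto
  then show ?thesis by simp
qed

text \<open>The numerator vanishes at q = 1, so the quotient tends to its derivative there.\<close>

lemma tendsto_powr_diff_quotient: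
  "((\<lambda>q. (q powr s - q powr t) / (q - 1)) \<longlongrightarrow> s - t) (at_left (1::real))"
proof -
  have "((\<lambda>q. q powr s - q powr t) has_real_derivative s - t) (at 1)"
    by (auto intro!: derivative_eq_intros)
  then have "((\<lambda>q. (q powr s - q powr t) / (q - 1)) \<longlongrightarrow> s - t) (at 1)"
    by (simp add: has_field_derivative_iff)
  then show ?thesis
    by (rule tendsto_mono [rotated]) (simp add: at_within_le_at)
qed

lemma eventually_at_left_1: "\<forall>\<^sub>F q in at_left (1::real). 0 < q \<and> q < 1"
  by (rule eventually_at_leftI [of 0]) auto

section \<open>The operators E_ij and their derivative at q = 1\<close>

lemma lookup_qT:
  assumes "0 < q"
  shows "Poly_Mapping.lookup (qT q f) n = of_real (q powr (n / 2)) * Poly_Mapping.lookup f n"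
    and "Poly_Mapping.lookup (qT_inv q f) n = of_real (q powr (- n / 2)) * Poly_Mapping.lookup f n"
  using assms
  by (simp_all add: qT_def qT_inv_def powr_powr flip: of_real_power_int powr_real_of_int')

text \<open>One sign \<sigma> serves both pairs of parameters: 1 for (a, c) and -1 for (b, d). Since
  \<sigma>^2 = 1, it survives only in the constant term.\<close>

lemma A_poly_expand:
  assumes "0 < q" "u $ i = of_real (\<sigma> * q powr p)" "u $ j = of_real (\<sigma> * q powr r)" "\<sigma>\<^sup>2 = 1"
  shows "A_poly q u i j = lconst (of_real (\<sigma> * (q powr (p - 1/2) + q powr (r - 1/2))))
    - lzinv - lconst (of_real (q powr (p + r - 1))) * lz"
proof -
  define a b where "a = lconst (of_real (\<sigma> * q powr (p - 1/2)))"
    and "b = lconst (of_real (\<sigma> * q powr (r - 1/2)))"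
  have \<sigma>\<sigma>: "\<sigma> * (\<sigma> * x) = x" for x
    using assms(4) by (simp add: power2_eq_square flip: mult.assoc)
  have ab: "lconst (of_real (q powr (p + r - 1))) = a * b"
    by (simp add: a_def b_def \<sigma>\<sigma> mult.left_commute mult.commute
        flip: lconst_mult of_real_mult powr_add)
  have half: "q powr (s - 1/2) = q powr s * q powr (- 1/2)" for s
    by (simp flip: powr_add)
  have "A_poly q u i j = - lzinv * (1 - a * lz) * (1 - b * lz)"
    using assms(2,3) by (simp add: A_poly_def a_def b_def mult.assoc half flip: of_real_mult)
  also have "\<dots> = (a + b) * (lz * lzinv) - lzinv - a * b * lz * (lz * lzinv)"
    by (simp add: algebra_simps del: lz_lzinv)
  also have "a + b = lconst (of_real (\<sigma> * (q powr (p - 1/2) + q powr (r - 1/2))))"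
    by (simp add: a_def b_def distrib_left lconst_add)
  finally show ?thesis
    by (simp add: ab)
qed


text \<open>The argument \<open>F q\<close> varies with \<open>q\<close> because the components of
  \<open>B_K_inv\<close> do. The limit is computed after multiplication by z - z^-1, where
  \<open>E_op\<close> becomes an explicit expression, and is then carried over to the
  quotient.\<close>

lemma E_op_limit:
  assumes u: "\<And>q. 0 < q \<Longrightarrow> u q $ i = of_real (\<sigma> * q powr p)"
      "\<And>q. 0 < q \<Longrightarrow> u q $ j = of_real (\<sigma> * q powr r)"
    and \<sigma>: "\<sigma>\<^sup>2 = 1"
    and F: "coeffs_tendsto F f (at_left 1)" "\<And>q. 0 < q \<Longrightarrow> F q \<in> sym_laurent"
    and f: "f \<in> sym_laurent"
  obtains g where
    "coeffs_tendsto (\<lambda>q. lconst (of_real (1 / (q - 1))) * E_op q (u q) i j (F q)) g (at_left 1)"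
    "(lz - lzinv) * g = (lconst (of_real (2 * \<sigma>)) - lz - lzinv) * z_deriv f
       - lconst (of_real (p + r - 1)) * (lz - lzinv) * f"
proof -
  define \<kappa> where "\<kappa> = p + r - 1"
  define \<alpha> where "\<alpha> q = \<sigma> * (q powr (p - 1/2) + q powr (r - 1/2))" for q
  define G where "G = (lconst (of_real (2 * \<sigma>)) - lz - lzinv) * z_deriv f
       - lconst (of_real \<kappa>) * (lz - lzinv) * f"
  define H where "H q = lconst (of_real (1 / (q - 1))) * E_op q (u q) i j (F q)" for q
  define N where "N q = (lz - lzinv) * H q" for q
  have \<alpha>: "(\<alpha> \<longlongrightarrow> 2 * \<sigma>) (at_left 1)"
    unfolding \<alpha>_def by (auto intro!: tendsto_eq_intros tendsto_powr_at_1)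
  have "Poly_Mapping.lookup f (- n) = Poly_Mapping.lookup f n" for n
    using f lookup_s1 [of f n] by (simp add: sym_laurent_def)
  then have "s1 (z_deriv f) = - z_deriv f"
    by (intro poly_mapping_eqI) simp
  then have "s1 G = - G"
    using f unfolding G_def
    by (simp only: s1_diff s1_mult sym_laurent_def mem_Collect_eq s1_lconst s1_lz s1_lzinv)
      (simp add: algebra_simps)
  \<comment> \<open>\<open>G\<close> is antisymmetric, so \<open>G - s1 G\<close> is twice
    \<open>G\<close>; halving shows that z - z^-1 divides \<open>G\<close> itself.\<close>
  then have "(lz - lzinv) dvd G + G"
    using dvd_minus_s1 [of G] by simp
  then have "(lz - lzinv) dvd lconst (1/2) * (G + G)"
    by (rule dvd_mult)
  also have "lconst (1/2) * (G + G) = G"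
    by (rule poly_mapping_eqI) (simp only: lookup_lconst_mult lookup_add, simp)
  finally obtain g where g: "G = (lz - lzinv) * g" by (auto elim: dvdE)
  \<comment> \<open>Grouping by coefficients of \<open>F q\<close> makes each difference of powers
    vanish at q = 1, so that every summand contains a difference quotient with a finite
    limit.\<close>
  have N: "Poly_Mapping.lookup (N q) n
      = of_real (\<alpha> q * ((q powr (n/2) - q powr (-n/2)) / (q - 1))) * Poly_Mapping.lookup (F q) n
      + of_real ((q powr (\<kappa> - (n+1)/2) - q powr ((n+1)/2)) / (q - 1)) * Poly_Mapping.lookup (F q) (n + 1)
      + of_real ((q powr (-(n-1)/2) - q powr (\<kappa> + (n-1)/2)) / (q - 1)) * Poly_Mapping.lookup (F q) (n - 1)"
    if q: "0 < q" "q < 1" for q n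
  proof -
    define c where "c = complex_of_real (1 / (q - 1))"
    define t where "t = q powr \<kappa>"
    have A: "A_poly q (u q) i j = lconst (of_real (\<alpha> q)) - lzinv - lconst (of_real t) * lz"
      unfolding \<alpha>_def \<kappa>_def t_def by (rule A_poly_expand) (use q u \<sigma> in simp_all)
    have sA: "s1 (A_poly q (u q) i j) = lconst (of_real (\<alpha> q)) - lz - lconst (of_real t) * lzinv"
      unfolding A by (simp add: s1_diff s1_mult)
    have "N q = lconst c * ((lz - lzinv) * E_op q (u q) i j (F q))"
      by (simp only: N_def H_def c_def mult.left_commute)
    also have "(lz - lzinv) * E_op q (u q) i j (F q)
      = A_poly q (u q) i j * qT q (F q) - s1 (A_poly q (u q) i j) * qT_inv q (F q)"
      by (rule E_op_eq) (use q F in auto)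
    finally have *: "Poly_Mapping.lookup (N q) n = c *
       (of_real (\<alpha> q) * (of_real (q powr (n/2)) * Poly_Mapping.lookup (F q) n)
        - of_real (q powr ((n+1)/2)) * Poly_Mapping.lookup (F q) (n+1)
        - of_real t * (of_real (q powr ((n-1)/2)) * Poly_Mapping.lookup (F q) (n-1))
        - (of_real (\<alpha> q) * (of_real (q powr (-n/2)) * Poly_Mapping.lookup (F q) n)
        - of_real (q powr (-(n-1)/2)) * Poly_Mapping.lookup (F q) (n-1)
        - of_real t * (of_real (q powr (-(n+1)/2)) * Poly_Mapping.lookup (F q) (n+1))))"
      using q unfolding sA unfolding A
      by (simp add: left_diff_distrib lookup_minus mult.assoc lookup_lz_mult
          lookup_lzinv_mult lookup_qT)
    have t: "q powr (\<kappa> + x) = t * q powr x" "q powr (\<kappa> - x) = t * q powr (- x)" for x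
      by (simp_all add: t_def flip: powr_add)
    show ?thesis
      unfolding * t c_def by (simp add: algebra_simps add_divide_distrib diff_divide_distrib)
  qed
  have "coeffs_tendsto N G (at_left 1)"
  proof -
    obtain M where "\<forall>\<^sub>F q in at_left 1. \<forall>n>M. Poly_Mapping.lookup (F q) n = 0"
      using F by (auto simp: coeffs_tendsto_def)
    \<comment> \<open>The factors z and z^-1 raise the degree bound by at most one.\<close>
    with eventually_at_left_1 have "\<forall>\<^sub>F q in at_left 1. \<forall>n>M+1. Poly_Mapping.lookup (N q) n = 0"
      by eventually_elim (auto simp: N)
    then show ?thesis
    proof (rule coeffs_tendstoI)
      fix n
      let ?F = "\<lambda>m q. Poly_Mapping.lookup (F q) m" and ?f = "Poly_Mapping.lookup f"
      have F': "(?F m \<longlongrightarrow> ?f m) (at_left 1)" for m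
        using F by (simp add: coeffs_tendsto_def)
      define x where "x = real_of_int n"
      have "((\<lambda>q. of_real (\<alpha> q * ((q powr (x/2) - q powr (-x/2)) / (q - 1))) * ?F n q
          + of_real ((q powr (\<kappa> - (x+1)/2) - q powr ((x+1)/2)) / (q - 1)) * ?F (n + 1) q
          + of_real ((q powr (-(x-1)/2) - q powr (\<kappa> + (x-1)/2)) / (q - 1)) * ?F (n - 1) q)
        \<longlongrightarrow> of_real (2 * \<sigma> * (x/2 - (-x/2))) * ?f n
          + of_real (\<kappa> - (x+1)/2 - (x+1)/2) * ?f (n + 1)
          + of_real (-(x-1)/2 - (\<kappa> + (x-1)/2)) * ?f (n - 1)) (at_left 1)"
        by (intro tendsto_intros \<alpha> F' tendsto_powr_diff_quotient)
      also have "of_real (2 * \<sigma> * (x/2 - (-x/2))) * ?f n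
          + of_real (\<kappa> - (x+1)/2 - (x+1)/2) * ?f (n + 1)
          + of_real (-(x-1)/2 - (\<kappa> + (x-1)/2)) * ?f (n - 1) = Poly_Mapping.lookup G n"
        by (simp add: G_def left_diff_distrib lookup_minus mult.assoc lookup_lz_mult
          lookup_lzinv_mult right_diff_distrib x_def) (simp add: field_simps)
      finally show "((\<lambda>q. Poly_Mapping.lookup (N q) n) \<longlongrightarrow> Poly_Mapping.lookup G n) (at_left 1)"
        by (rule Lim_transform_eventually) (use eventually_at_left_1 in \<open>eventually_elim, simp add: N x_def\<close>)
    qed
  qed
  then have "coeffs_tendsto H g (at_left 1)"
    unfolding g by (rule coeffs_tendsto_div_lz_diff_lzinv) (simp add: N_def)
  then have "coeffs_tendsto (\<lambda>q. lconst (of_real (1 / (q - 1))) * E_op q (u q) i j (F q)) g (at_left 1)"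
    unfolding H_def .
  then show thesis
    by (rule that) (use g in \<open>simp only: G_def \<kappa>_def\<close>)
qed

section \<open>The map \<open>B_K\<close>, its inverse and its limit\<close>

lemma B_K_eq:
  "B_K u (f, g) = f + (lzinv * g - lconst (u $ 1 + u $ 2) * g + lconst (u $ 1 * u $ 2) * (lz * g))"
proof -
  have "B_K u (f, g) = f + (lzinv * g - (lconst (u $ 1) + lconst (u $ 2)) * (lz * lzinv) * g
      + lconst (u $ 1) * lconst (u $ 2) * lz * (lz * lzinv) * g)"
    unfolding B_K_def by (simp add: algebra_simps del: lz_lzinv)
  then show ?thesis by (simp add: lconst_add lconst_mult mult.assoc)
qed

text \<open>With w = z^-1 (1 - a z) (1 - b z), the equation f = f1 + w f2 gives f - s1 f = (w - s1
  w) f2, and w - s1 w = -(1 - a b) (z - z^-1). Cancelling z - z^-1 yields \<open>f2\<close>. Since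
  \<open>g0\<close> depends on \<open>f\<close> alone, the parameters enter \<open>f2\<close> only
  through a scalar.\<close>

lemma B_K_inv_eq:
  assumes "u $ 1 * u $ 2 \<noteq> 1" "f - s1 f = (lz - lzinv) * g0"
  defines "f2 \<equiv> lconst (- inverse (1 - u $ 1 * u $ 2)) * g0"
  defines "f1 \<equiv> f - B_K u (0, f2)"
  shows "B_K_inv u f = (f1, f2)" "f1 \<in> sym_laurent" "f2 \<in> sym_laurent"
proof -
  obtain h1 h2 where h: "h1 \<in> sym_laurent" "h2 \<in> sym_laurent" "f = B_K u (h1, h2)"
  proof -
    have "f \<in> B_K u ` (sym_laurent \<times> sym_laurent)"
      using bij_betw_B_K [OF assms(1)] by (simp add: bij_betw_def)
    with that show thesis by blast
  qed
  define e where "e = 1 - u $ 1 * u $ 2"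
  have e: "e \<noteq> 0" using assms(1) by (simp add: e_def)
  have "f - s1 f = (lz - lzinv) * (- lconst e * h2)"
    unfolding h(3) B_K_eq using h(1,2)
    by (simp add: s1_add s1_diff s1_mult sym_laurent_def e_def lconst_diff algebra_simps)
  then have "(lz - lzinv) * g0 = (lz - lzinv) * (- lconst e * h2)"
    unfolding assms(2) .
  moreover have "lz - lzinv \<noteq> 0" by simp
  ultimately have "g0 = - lconst e * h2"
    using mult_left_cancel by blast
  then have 2: "f2 = h2"
    using e by (intro poly_mapping_eqI) (simp add: f2_def e_def [symmetric])
  then have 1: "f1 = h1" by (simp add: f1_def h(3) B_K_eq)
  show "B_K_inv u f = (f1, f2)" "f1 \<in> sym_laurent" "f2 \<in> sym_laurent"
    using h bij_betw_B_K [OF assms(1)]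
    by (auto simp: B_K_inv_def 1 2 bij_betw_def intro!: inv_into_f_eq)
qed

text \<open>Here a tends to 1 and b to -1 for every \<open>k\<close>, so the factor of the second
  component tends to z^-1 - z. The lemma thus serves both the decomposition of \<open>f\<close> and
  the outer map at shifted parameters.\<close>

lemma coeffs_tendsto_B_K:
  assumes "coeffs_tendsto F f (at_left 1)" "coeffs_tendsto G g (at_left 1)"
  shows "coeffs_tendsto (\<lambda>q. B_K (params q k) (F q, G q)) (f + (lzinv - lz) * g) (at_left 1)"
proof -
  have "((\<lambda>q. params q k $ 1 + params q k $ 2) \<longlongrightarrow> 0) (at_left 1)"
    "((\<lambda>q. params q k $ 1 * params q k $ 2) \<longlongrightarrow> - 1) (at_left 1)"
    unfolding params_def vector_4
    by (auto intro!: tendsto_eq_intros tendsto_powr_at_1)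
  then have "coeffs_tendsto (\<lambda>q. B_K (params q k) (F q, G q))
      (f + (lzinv * g - lconst 0 * g + lconst (- 1) * (lz * g))) (at_left 1)"
    unfolding B_K_eq
    by (intro coeffs_tendsto_add coeffs_tendsto_diff coeffs_tendsto_lconst_mult
        coeffs_tendsto_lz_mult coeffs_tendsto_lzinv_mult assms)
  also have "f + (lzinv * g - lconst 0 * g + lconst (- 1) * (lz * g)) = f + (lzinv - lz) * g"
    by (rule poly_mapping_eqI) (simp add: lookup_add lookup_minus left_diff_distrib)
  finally show ?thesis .
qed

section \<open>The limit computation common to both operators\<close>

text \<open>The instances are (i, j) = (1, 3), \<sigma> = 1, \<open>h = - v3\<close> and (i, j) =
  (2, 4), \<sigma> = -1, \<open>h = v3\<close>. The factor \<sigma> on the last term produces its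
  opposite signs in the two limits.\<close>

lemma nonsym_E2_limit:
  fixes k h :: "real ^ 4"
  assumes par: "\<And>q k. 0 < q \<Longrightarrow> params q k $ i = of_real (\<sigma> * q powr (k $ i))"
      "\<And>q k. 0 < q \<Longrightarrow> params q k $ j = of_real (\<sigma> * q powr (k $ j + 1/2))"
    and eps: "(eps 1 + eps 2) $ i = 1" "(eps 1 + eps 2) $ j = 0"
    and \<sigma>: "\<sigma>\<^sup>2 = 1"
    and P: "\<And>q u. P q u = B_K (kshift q h u) \<circ>
      map_prod (E_op q u i j) (\<lambda>f. lconst (complex_of_real (q powr (- 1/2)))
        * E_op q (kshift q (eps 1 + eps 2) u) i j f) \<circ> B_K_inv u"
  shows "specialises
    (\<lambda>q f. lconst (complex_of_real (1 / (q - 1))) * P q (params q k) f)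
    (\<lambda>f. - ((1 - to_fract (lconst (of_real \<sigma>) * lzinv)) / (1 + to_fract (lconst (of_real \<sigma>) * lzinv))
         * to_fract (z_deriv f)
       + to_fract (lconst (of_real (k $ i + k $ j - 1/2)) * f)
       + to_fract (lconst (of_real \<sigma>)) *
         ((1 - to_fract (lconst (of_real \<sigma>) * lzinv)) / (1 + to_fract (lconst (of_real \<sigma>) * lzinv))
         * (1 / (to_fract lz - to_fract lzinv)) * to_fract (f - s1 f))))"
  unfolding specialises_def
proof
  fix f
  define \<kappa> where "\<kappa> = k $ i + k $ j - 1/2"
  define S where "S = lconst (of_real \<sigma>)"
  obtain g0 where g0: "f - s1 f = (lz - lzinv) * g0"
    using dvd_minus_s1 by (auto elim: dvdE)
  have nd: "params q k $ 1 * params q k $ 2 \<noteq> 1" if "0 < q" for q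
    by (rule params_nondegenerate [OF that])
  define F2 where "F2 q = lconst (- inverse (1 - params q k $ 1 * params q k $ 2)) * g0" for q
  define F1 where "F1 q = f - B_K (params q k) (0, F2 q)" for q
  note F = B_K_inv_eq [OF nd g0, folded F2_def F1_def]
  \<comment> \<open>The scalar is the limit of -1 / (1 - a b), as a b tends to -1.\<close>
  define f2 where "f2 = lconst (- 1/2) * g0"
  define f1 where "f1 = f - (0 + (lzinv - lz) * f2)"
  have "((\<lambda>q. - inverse (1 - params q k $ 1 * params q k $ 2)) \<longlongrightarrow> - 1/2) (at_left 1)"
    unfolding params_def vector_4
    by (auto intro!: tendsto_eq_intros tendsto_powr_at_1)
  then have F2: "coeffs_tendsto F2 f2 (at_left 1)"
    unfolding F2_def f2_def by (intro coeffs_tendsto_lconst_mult coeffs_tendsto_const)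
  then have F1: "coeffs_tendsto F1 f1 (at_left 1)"
    unfolding F1_def f1_def
    by (intro coeffs_tendsto_diff coeffs_tendsto_const coeffs_tendsto_B_K)
  have "s1 (f - s1 f) = - (f - s1 f)" by (simp add: s1_diff)
  then have "(lz - lzinv) * s1 g0 = (lz - lzinv) * g0"
    unfolding g0 by (simp add: s1_mult s1_diff algebra_simps)
  then have f2: "f2 \<in> sym_laurent" by (simp add: f2_def s1_mult sym_laurent_def)
  have "lconst (- 1/2) + lconst (- 1/2) = lconst (- 1/2 - 1/2)"
    by (simp flip: lconst_add)
  also have "\<dots> = - 1"
    by (simp add: lconst_def single_uminus)
  finally have g0_f2: "g0 = - f2 - f2"
    unfolding f2_def by algebra
  have "s1 f = f - (lz - lzinv) * g0"
    by (simp flip: g0)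
  then have f1: "f1 \<in> sym_laurent"
    using f2 unfolding f1_def g0_f2
    by (simp only: s1_diff s1_add s1_0 s1_mult sym_laurent_def mem_Collect_eq s1_lz s1_lzinv)
      (simp add: algebra_simps)
  let ?c = "\<lambda>q. lconst (of_real (1 / (q - 1)))"
  obtain g1 where g1:
    "coeffs_tendsto (\<lambda>q. ?c q * E_op q (params q k) i j (F1 q)) g1 (at_left 1)"
    "(lz - lzinv) * g1 = (lconst (of_real (2 * \<sigma>)) - lz - lzinv) * z_deriv f1
       - lconst (of_real (k $ i + (k $ j + 1/2) - 1)) * (lz - lzinv) * f1"
    by (rule E_op_limit [OF par(1) par(2) \<sigma> F1 F(2) f1])
  let ?k = "k + (eps 1 + eps 2)"
  obtain g2 where g2:
    "coeffs_tendsto (\<lambda>q. ?c q * E_op q (params q ?k) i j (F2 q)) g2 (at_left 1)"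
    "(lz - lzinv) * g2 = (lconst (of_real (2 * \<sigma>)) - lz - lzinv) * z_deriv f2
       - lconst (of_real (?k $ i + (?k $ j + 1/2) - 1)) * (lz - lzinv) * f2"
    by (rule E_op_limit [OF par(1) par(2) \<sigma> F2 F(3) f2])
  \<comment> \<open>\<open>lconst 1\<close> is the limit of the factor q^(-1/2).\<close>
  define g where "g = g1 + (lzinv - lz) * (lconst 1 * g2)"
  have "((\<lambda>q. complex_of_real (q powr (- 1/2))) \<longlongrightarrow> of_real 1) (at_left 1)"
    by (intro tendsto_of_real tendsto_powr_at_1)
  then have lim: "coeffs_tendsto (\<lambda>q. B_K (params q (k + h)) (?c q * E_op q (params q k) i j (F1 q),
      lconst (of_real (q powr (- 1/2))) * (?c q * E_op q (params q ?k) i j (F2 q)))) g (at_left 1)"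
    unfolding g_def of_real_1
    by (intro coeffs_tendsto_B_K coeffs_tendsto_lconst_mult g1 g2)
  \<comment> \<open>Linearity moves 1 / (q - 1) inside \<open>B_K\<close> onto each
    \<open>E_op\<close>, where the limits are known.\<close>
  have B_K_scale: "lconst c * B_K u (x, y) = B_K u (lconst c * x, lconst c * y)" for c u x y
    by (simp add: B_K_def algebra_simps)
  have eq: "B_K (params q (k + h)) (?c q * E_op q (params q k) i j (F1 q),
      lconst (of_real (q powr (- 1/2))) * (?c q * E_op q (params q ?k) i j (F2 q)))
    = ?c q * P q (params q k) f" if "0 < q" for q
    unfolding P using that
    by (simp only: o_apply F(1) map_prod_simp B_K_scale kshift_params mult.left_commute)
  have "\<forall>n. ((\<lambda>q. Poly_Mapping.lookup (?c q * P q (params q k) f) n)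
      \<longlongrightarrow> Poly_Mapping.lookup g n) (at_left 1)"
  proof
    fix n
    have "((\<lambda>q. Poly_Mapping.lookup (B_K (params q (k + h)) (?c q * E_op q (params q k) i j (F1 q),
        lconst (of_real (q powr (- 1/2))) * (?c q * E_op q (params q ?k) i j (F2 q)))) n)
        \<longlongrightarrow> Poly_Mapping.lookup g n) (at_left 1)"
      using lim unfolding coeffs_tendsto_def by (rule conjunct2 [THEN spec])
    then show "((\<lambda>q. Poly_Mapping.lookup (?c q * P q (params q k) f) n)
        \<longlongrightarrow> Poly_Mapping.lookup g n) (at_left 1)"
      by (rule Lim_transform_eventually)
        (use eventually_at_left_1 in \<open>eventually_elim, simp only: eq\<close>)
  qed
  moreover have "to_fract g = - ((1 - to_fract (S * lzinv)) / (1 + to_fract (S * lzinv))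
         * to_fract (z_deriv f) + to_fract (lconst (of_real \<kappa>) * f)
       + to_fract S * ((1 - to_fract (S * lzinv)) / (1 + to_fract (S * lzinv))
         * (1 / (to_fract lz - to_fract lzinv)) * to_fract (f - s1 f)))"
  proof -
    let ?K = "lconst (of_real \<kappa>)"
    have S2: "S * S = 1"
      using \<sigma> by (simp add: S_def power2_eq_square flip: lconst_mult of_real_mult)
    have S: "lconst (of_real (2 * \<sigma>)) = S + S"
      by (simp add: S_def flip: lconst_add)
    have K: "k $ i + (k $ j + 1/2) - 1 = \<kappa>" "?k $ i + (?k $ j + 1/2) - 1 = \<kappa> + 1"
      using eps by (simp_all add: \<kappa>_def)
    have K1: "lconst (of_real (\<kappa> + 1)) = ?K + 1"
      by (simp add: lconst_add)
    have f: "f = f1 + (lzinv - lz) * f2" by (simp add: f1_def)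
    have Df: "z_deriv f = z_deriv f1 + (lzinv - lz) * z_deriv f2 - (lz + lzinv) * f2"
      unfolding f
      by (rule poly_mapping_eqI)
        (simp add: lookup_add lookup_minus lookup_lz_mult lookup_lzinv_mult algebra_simps)
    define Q where "Q = S + S - lz - lzinv"
    \<comment> \<open>By this factorization the extra term (z - z^-1)^2 f2, which comes from
      \<kappa> + 1 in place of \<kappa>, becomes a multiple of \<open>Q\<close>. Its part with z +
      z^-1 completes the derivative of \<open>f\<close>; the rest is \<open>S * g0\<close>, since g0
      = -2 f2.\<close>
    have Q: "(lz - lzinv) * (lz - lzinv) = - Q * (lz + lzinv + S + S)"
      using S2 lz_lzinv(1) unfolding Q_def by algebra
    have "(lz - lzinv) * g = (lz - lzinv) * g1 + (lzinv - lz) * ((lz - lzinv) * g2)"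
      by (simp add: g_def algebra_simps)
    also have "\<dots> = Q * (z_deriv f1 + (lzinv - lz) * z_deriv f2) - ?K * (lz - lzinv) * f
        + (lz - lzinv) * (lz - lzinv) * f2"
      unfolding g1(2) g2(2) K S K1 f Q_def [symmetric] by (simp add: algebra_simps)
    also have "\<dots> = Q * (z_deriv f + S * g0) - ?K * (lz - lzinv) * f"
      unfolding Q Df g0_f2 by (simp add: algebra_simps)
    finally have "(lz - lzinv) * g
        = (S + S - lz - lzinv) * (z_deriv f + S * g0) - ?K * (lz - lzinv) * f"
      unfolding Q_def .
    then have "to_fract ((lz - lzinv) * g) =
        to_fract ((S + S - lz - lzinv) * (z_deriv f + S * g0) - ?K * (lz - lzinv) * f)"
      by (rule arg_cong)
    moreover define Z W T where "Z = to_fract lz" and "W = to_fract lzinv" and "T = to_fract S"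
    ultimately have *: "(Z - W) * to_fract g = (T + T - Z - W) * (to_fract (z_deriv f) + T * to_fract g0)
        - to_fract ?K * (Z - W) * to_fract f"
      by (simp only: to_fract_mult to_fract_diff to_fract_add Z_def W_def T_def)
    have ZW: "Z * W = 1" and TT: "T * T = 1"
      using S2 by (simp_all add: Z_def W_def T_def flip: to_fract_mult)
    have "Z - W \<noteq> 0" by (simp add: Z_def W_def)
    have TW: "1 + T * W \<noteq> 0"
    proof
      assume "1 + T * W = 0"
      \<comment> \<open>T W = -1 forces W^2 = 1 because T^2 = 1, hence z^-1 = z.\<close>
      then have "W * W = Z * W" using ZW TT by algebra
      moreover have "W \<noteq> 0" using ZW by auto
      ultimately show False using \<open>Z - W \<noteq> 0\<close> by simp
    qed
    define R where "R = (1 - T * W) / (1 + T * W)"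
    have "R * (1 + T * W) = 1 - T * W" using TW by (simp add: R_def)
    \<comment> \<open>This identifies the polynomial factor 2 \<sigma> - z - z^-1 with the rational
      factor of the limit operator, up to sign and the denominator z - z^-1.\<close>
    then have "(1 + T * W) * (R * (Z - W)) = (1 + T * W) * - (T + T - Z - W)"
      using ZW TT by algebra
    then have R: "R * (Z - W) = - (T + T - Z - W)"
      by (rule mult_left_cancel [OF TW, THEN iffD1])
    have inv: "(Z - W) * (1 / (Z - W)) = 1" using \<open>Z - W \<noteq> 0\<close> by simp
    have "(Z - W) * to_fract g = (Z - W) * - (R * to_fract (z_deriv f) + to_fract ?K * to_fract f
        + T * (R * (1 / (Z - W)) * ((Z - W) * to_fract g0)))"
      using * R inv by algebra
    then have "to_fract g = - (R * to_fract (z_deriv f) + to_fract ?K * to_fract f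
        + T * (R * (1 / (Z - W)) * ((Z - W) * to_fract g0)))"
      by (rule mult_left_cancel [OF \<open>Z - W \<noteq> 0\<close>, THEN iffD1])
    then show ?thesis
      unfolding g0 by (simp add: R_def Z_def W_def T_def)
  qed
  ultimately show "\<exists>g. to_fract g = - ((1 - to_fract (lconst (of_real \<sigma>) * lzinv)) / (1 + to_fract (lconst (of_real \<sigma>) * lzinv))
         * to_fract (z_deriv f)
       + to_fract (lconst (of_real (k $ i + k $ j - 1/2)) * f)
       + to_fract (lconst (of_real \<sigma>)) *
         ((1 - to_fract (lconst (of_real \<sigma>) * lzinv)) / (1 + to_fract (lconst (of_real \<sigma>) * lzinv))
         * (1 / (to_fract lz - to_fract lzinv)) * to_fract (f - s1 f))) \<and>
      (\<forall>n. ((\<lambda>q. Poly_Mapping.lookup (?c q * P q (params q k) f) n)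
        \<longlongrightarrow> Poly_Mapping.lookup g n) (at_left 1))"
    unfolding S_def \<kappa>_def by (intro exI [of _ g] conjI)
qed

section \<open>The two signs\<close>

theorem corollary6p8:
  fixes k :: "real ^ 4"
  shows "specialises
           (\<lambda>q f. lconst (complex_of_real (1 / (q - 1))) * nonsym_E2_plus q (params q k) f)
           (E2_plus_limit k)
    \<and> specialises
           (\<lambda>q f. lconst (complex_of_real (1 / (q - 1))) * nonsym_E2_minus q (params q k) f)
           (E2_minus_limit k)"
proof
  have eps: "(eps 1 + eps 2) $ (1::4) = 1" "(eps 1 + eps 2) $ (3::4) = 0"
    "(eps 1 + eps 2) $ (2::4) = 1" "(eps 1 + eps 2) $ (4::4) = 0"
    by (simp_all add: eps_def axis_def)
  have L: "lconst (- 1) = - 1"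
    by (simp add: lconst_def single_uminus)
  show "specialises
      (\<lambda>q f. lconst (complex_of_real (1 / (q - 1))) * nonsym_E2_plus q (params q k) f)
      (E2_plus_limit k)"
  proof -
    have "specialises
      (\<lambda>q f. lconst (complex_of_real (1 / (q - 1))) * nonsym_E2_plus q (params q k) f)
      (\<lambda>f. - ((1 - to_fract (lconst (of_real 1) * lzinv)) / (1 + to_fract (lconst (of_real 1) * lzinv))
         * to_fract (z_deriv f)
       + to_fract (lconst (of_real (k $ 1 + k $ 3 - 1/2)) * f)
       + to_fract (lconst (of_real 1)) *
         ((1 - to_fract (lconst (of_real 1) * lzinv)) / (1 + to_fract (lconst (of_real 1) * lzinv))
         * (1 / (to_fract lz - to_fract lzinv)) * to_fract (f - s1 f))))"
      by (rule nonsym_E2_limit [OF _ _ eps(1,2) _ nonsym_E2_plus_def])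
        (simp_all add: params_def vector_4)
    then show ?thesis
      by (simp only: E2_plus_limit_def [abs_def] of_real_1 lconst_1 mult_1_left to_fract_1)
  qed
  show "specialises
      (\<lambda>q f. lconst (complex_of_real (1 / (q - 1))) * nonsym_E2_minus q (params q k) f)
      (E2_minus_limit k)"
  proof -
    have "specialises
      (\<lambda>q f. lconst (complex_of_real (1 / (q - 1))) * nonsym_E2_minus q (params q k) f)
      (\<lambda>f. - ((1 - to_fract (lconst (of_real (- 1)) * lzinv)) / (1 + to_fract (lconst (of_real (- 1)) * lzinv))
         * to_fract (z_deriv f)
       + to_fract (lconst (of_real (k $ 2 + k $ 4 - 1/2)) * f)
       + to_fract (lconst (of_real (- 1))) *
         ((1 - to_fract (lconst (of_real (- 1)) * lzinv)) / (1 + to_fract (lconst (of_real (- 1)) * lzinv))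
         * (1 / (to_fract lz - to_fract lzinv)) * to_fract (f - s1 f))))"
      by (rule nonsym_E2_limit [OF _ _ eps(3,4) _ nonsym_E2_minus_def])
        (simp_all add: params_def vector_4)
    then show ?thesis
      by (simp only: E2_minus_limit_def [abs_def] of_real_minus of_real_1 L mult_1_left mult_minus_left
        to_fract_uminus to_fract_1 diff_minus_eq_add add_uminus_conv_diff)
  qed
qed

end
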